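(* Let $X$ be an arbitrary non-negative real random variable with distribution function $F$ and finite positive mean $\mu_F$. Define a sequence of distribution functions on $\mathbb{R}$ by $H_0^F = F$ and $H_{n+1}^F = L^{H_n^F}$ for $n = 0, 1, 2, \dots$, where, for a distribution function $H$ of a non-negative random variable with finite positive mean, $L^H$ denotes its Lorenz curve, extended by $0$ to the left of $[0,1]$ and by $1$ to the right of $[0,1]$ and regarded as a distribution function. Then, as $n \to \infty$, $H_n^F(x)$ converges uniformly in $x \in \mathbb{R}$ to the distribution function $$G(x) = \begin{cases} 0, & x < 0,\\ x^{\frac{1+\sqrt{5}}{2}}, & 0 \le x \le 1,\\ 1, & x > 1.\end{cases}$$
   Context: For a distribution function $H$ of a non-negative random variable, its generalized inverse is $H^{-1}(u) = \inf\{y : H(y) \ge u\}$ for $0 \le u \le 1$ (the values at the endpoints $u = 0, 1$ are irrelevant for the integrals below), and its mean is $\mu_H = \int_0^1 H^{-1}(u)\,du$. If $0 < \mu_H < \infty$, the Lorenz curve of $H$ is $$L^H(x) = \frac{\int_0^x H^{-1}(u)\,du}{\int_0^1 H^{-1}(u)\,du}, \qquad 0 \le x \le 1,$$ extended to $\mathbb{R}$ by $L^H(x) = 0$ for $x < 0$ and $L^H(x) = 1$ for $x > 1$. With this extension $L^H$ is itself the distribution function of a random variable with values in $[0,1]$, so the construction can be iterated. *)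

theory Defs
  imports "HOL-Probability.Probability"
begin

text \<open>
  Distribution functions are plain functions on the reals. The values at levels \<open>0\<close> and \<open>1\<close>, where
  the set below may be unbounded or empty, are unspecified; they do not affect any of the integrals.
\<close>

definition gen_inverse :: "(real \<Rightarrow> real) \<Rightarrow> real \<Rightarrow> real" where
  "gen_inverse H u = Inf {y. u \<le> H y}"

definition df_mean :: "(real \<Rightarrow> real) \<Rightarrow> real" where
  "df_mean H = (LBINT u:{0..1}. gen_inverse H u)"

lemma df_mean_cdf:
  fixes M :: "'a measure" and X :: "'a \<Rightarrow> real"
  assumes "prob_space M" and X: "X \<in> borel_measurable M"
  shows "df_mean (cdf (distr M borel X)) = prob_space.expectation M X"
proof -
  interpret prob_space M by fact
  let ?D = "distr M borel X"
  interpret D: cdf_distribution ?D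
    by (simp add: cdf_distribution_def real_distribution_distr X)
  have "prob_space.expectation M X = (LINT x|?D. x)"
    using X by (simp add: integral_distr)
  also have "\<dots> = (LINT x|distr (restrict_space lborel {0<..<1::real}) borel D.I. x)"
    by (simp only: D.distr_I_eq_M)
  also have "\<dots> = (LINT u|restrict_space lborel {0<..<1}. D.I u)"
  proof (rule integral_distr)
    show "D.I \<in> restrict_space lborel {0<..<1} \<rightarrow>\<^sub>M borel"
      using D.measurable_CI by simp
  qed simp
  also have "\<dots> = (LBINT u:{0<..<1}. D.I u)"
    by (simp add: set_lebesgue_integral_def integral_restrict_space)
  also have "\<dots> = (LBINT u:{0..1}. gen_inverse (cdf ?D) u)"
    unfolding set_lebesgue_integral_def gen_inverse_def
  proof -
    have ae: "AE u in lborel. u \<noteq> 0 \<and> u \<noteq> (1::real)"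
      using AE_lborel_singleton[of "0::real"] AE_lborel_singleton[of "1::real"] by eventually_elim simp
    have m1: "(\<lambda>u. indicat_real {0<..<1} u *\<^sub>R D.I u) \<in> borel_measurable lborel"
      using D.measurable_CI by (simp add: borel_measurable_restrict_space_iff)
    have eq: "(\<lambda>u. indicat_real {0..1} u *\<^sub>R D.I u) =
        (\<lambda>u. indicat_real {0<..<1} u *\<^sub>R D.I u + indicat_real {0} u * D.I 0 + indicat_real {1} u * D.I 1)"
      by (auto simp: indicator_def fun_eq_iff)
    have m2: "(\<lambda>u. indicat_real {0..1} u *\<^sub>R D.I u) \<in> borel_measurable lborel"
      unfolding eq by (intro borel_measurable_add m1) measurable
    show "(LBINT u. indicat_real {0<..<1} u *\<^sub>R D.I u) =
          (LBINT u. indicat_real {0..1} u *\<^sub>R D.I u)"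
    proof (intro integral_cong_AE m1 m2)
      show "AE u in lborel. indicat_real {0<..<1} u *\<^sub>R D.I u = indicat_real {0..1} u *\<^sub>R D.I u"
        using ae by eventually_elim (auto simp: indicator_def)
    qed
  qed
  finally show ?thesis
    by (simp add: df_mean_def)
qed

definition lorenz :: "(real \<Rightarrow> real) \<Rightarrow> real \<Rightarrow> real" where
  "lorenz H x =
     (if x < 0 then 0
      else if x \<le> 1 then (LBINT u:{0..x}. gen_inverse H u) / df_mean H
      else 1)"

primrec lorenz_iter :: "(real \<Rightarrow> real) \<Rightarrow> nat \<Rightarrow> real \<Rightarrow> real" where
  "lorenz_iter F 0 = F"
| "lorenz_iter F (Suc n) = lorenz (lorenz_iter F n)"

definition golden_df :: "real \<Rightarrow> real" where
  "golden_df x =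
     (if x < 0 then 0
      else if x \<le> 1 then x powr ((1 + sqrt 5) / 2)
      else 1)"

end

theory Submission
  imports Defs
begin

text \<open>
  Measure the growth of a function \<open>f\<close> by its elasticity \<open>x f'(x) / f(x)\<close>. The two operations
  that make up the Lorenz transform act on bounds for it in the simplest possible way: inversion
  turns a bound \<open>e\<close> into \<open>1 / e\<close>, and integration from \<open>0\<close> turns \<open>e\<close> into \<open>1 + e\<close>. The
  normalisation by the mean, which destroys any pointwise comparison of distribution functions,
  does not affect elasticities at all. So if the elasticity of \<open>L\<close> lies in \<open>[a, b]\<close>, that of its
  Lorenz curve lies in \<open>[1 + 1 / b, 1 + 1 / a]\<close> (\<open>gen_inverse_elasticity_ge\<close>,
  \<open>lorenz_elasticity_ge\<close> and their duals).

  The map \<open>c \<mapsto> 1 + 1 / c\<close> fixes the golden ratio and contracts distances to it by the factor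
  \<open>1 / golden_ratio\<close> on \<open>[1, \<infinity>)\<close> (\<open>golden_ratio_contraction\<close>), so both bounds converge to the
  golden ratio as soon as they are finite. Finite bounds come for free: a quantile function is
  nondecreasing, so every Lorenz curve has elasticity at least \<open>1\<close>; hence its inverse has
  elasticity at most \<open>1\<close>, and a second Lorenz curve has elasticity in \<open>[1, 2]\<close>
  (\<open>lorenz_lorenz_nearly_golden\<close>).

  Finally, elasticity in \<open>[a, b]\<close> together with \<open>L 1 = 1\<close> gives \<open>x powr b \<le> L x \<le> x powr a\<close> on the
  unit interval, and powers with exponents at least \<open>1\<close> depend on the exponent in a \<open>1\<close>-Lipschitz
  way, uniformly in \<open>x\<close> (\<open>powr_diff_exponent_le\<close>). The convergence is thus uniform, with error at
  most \<open>(1 / golden_ratio) ^ n\<close> after \<open>n + 2\<close> steps.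
\<close>

section \<open>Elasticity bounds\<close>

text \<open>
  For a positive differentiable \<open>f\<close> on \<open>{0<..1}\<close> these conditions say that the elasticity
  \<open>x f'(x) / f(x)\<close> is at least, respectively at most, \<open>p\<close>. This integrated form makes sense
  for functions with jumps and flat pieces, and it passes through a generalized inverse, because
  it only compares values at two points.
\<close>
definition elasticity_ge_on :: "real set \<Rightarrow> real \<Rightarrow> (real \<Rightarrow> real) \<Rightarrow> bool" where
  "elasticity_ge_on S p f \<longleftrightarrow> (\<forall>t\<in>{0<..1}. \<forall>x\<in>S. f (t * x) \<le> t powr p * f x)"

definition elasticity_le_on :: "real set \<Rightarrow> real \<Rightarrow> (real \<Rightarrow> real) \<Rightarrow> bool" where
  "elasticity_le_on S p f \<longleftrightarrow> (\<forall>t\<in>{0<..1}. \<forall>x\<in>S. t powr p * f x \<le> f (t * x))"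

text \<open>
  Integrability of the quantile function is implied by the last conjunct: a Bochner integral that
  does not exist has the value \<open>0\<close>. The levels \<open>0\<close> and \<open>1\<close> are left out because the quantile there
  may be an arbitrary value: every argument reaches level \<open>0\<close>, possibly none reaches level \<open>1\<close>.
\<close>
definition has_lorenz_curve :: "(real \<Rightarrow> real) \<Rightarrow> bool" where
  "has_lorenz_curve H \<longleftrightarrow> mono_on {0<..<1} (gen_inverse H)
     \<and> (\<forall>u\<in>{0<..<1}. 0 \<le> gen_inverse H u) \<and> 0 < df_mean H"

definition unit_interval_df :: "(real \<Rightarrow> real) \<Rightarrow> bool" where
  "unit_interval_df L \<longleftrightarrow> mono L \<and> (\<forall>x\<le>0. L x = 0) \<and> (\<forall>x\<ge>1. L x = 1)"

section \<open>Integration raises elasticity by one\<close>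

lemma lborel_set_integral_Icc_eq_Ioo:
  fixes g :: "real \<Rightarrow> real"
  assumes "a \<le> b"
  shows "(LBINT u:{a..b}. g u) = (LBINT u:{a<..<b}. g u)"
  using interval_integral_Icc[OF assms, of g] interval_integral_Ioo[of a b g] assms by simp

lemma lborel_set_integral_scale:
  fixes g :: "real \<Rightarrow> real"
  assumes "0 < s"
  shows "(LBINT u:{0<..<s * x}. g u) = s * (LBINT u:{0<..<x}. g (s * u))"
proof -
  have "indicator {0<..<s * x} (s * u) = (indicator {0<..<x} u :: real)" for u
    using assms by (auto simp: indicator_def zero_less_mult_iff)
  then show ?thesis
    unfolding set_lebesgue_integral_def
    using assms by (subst lborel_integral_real_affine[where c = s and t = 0]) auto
qed

lemma lborel_set_integrable_scale:
  fixes g :: "real \<Rightarrow> real"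
  assumes "0 < s" and "set_integrable lborel {0<..<s * x} g"
  shows "set_integrable lborel {0<..<x} (\<lambda>u. g (s * u))"
proof -
  have "indicator {0<..<s * x} (s * u) = (indicator {0<..<x} u :: real)" for u
    using assms(1) by (auto simp: indicator_def zero_less_mult_iff)
  then show ?thesis
    using lborel_integrable_real_affine[OF assms(2)[unfolded set_integrable_def], of s 0] assms(1)
    unfolding set_integrable_def by simp
qed

lemma df_mean_eq_Ioo: "df_mean H = (LBINT u:{0<..<1}. gen_inverse H u)"
  by (simp add: df_mean_def lborel_set_integral_Icc_eq_Ioo)

lemma lorenz_eq_Ioo:
  assumes "0 \<le> x" "x \<le> 1"
  shows "lorenz H x = (LBINT u:{0<..<x}. gen_inverse H u) / df_mean H"
  using assms by (simp add: lorenz_def lborel_set_integral_Icc_eq_Ioo)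

lemma has_lorenz_curve_integrable:
  assumes "has_lorenz_curve H" "x \<le> 1"
  shows "set_integrable lborel {0<..<x} (gen_inverse H)"
proof -
  have "set_integrable lborel {0<..<1} (gen_inverse H)"
    using assms(1) not_integrable_integral_eq
    unfolding has_lorenz_curve_def df_mean_eq_Ioo set_lebesgue_integral_def set_integrable_def
    by fastforce
  then show ?thesis
    by (rule set_integrable_subset) (use assms(2) in auto)
qed

text \<open>
  Substituting \<open>s * u\<close> for the integration variable in \<open>lorenz H (s * x)\<close> produces one factor \<open>s\<close>
  from the measure and a factor bounded by \<open>s powr p\<close> from the quantile function; the mean cancels.
\<close>
lemma lorenz_elasticity_ge:
  assumes H: "has_lorenz_curve H" and p: "elasticity_ge_on {0<..<1} p (gen_inverse H)"
  shows "elasticity_ge_on {0<..1} (1 + p) (lorenz H)"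
  unfolding elasticity_ge_on_def
proof (intro ballI)
  fix s x :: real
  assume s: "s \<in> {0<..1}" and x: "x \<in> {0<..1}"
  have sx: "0 \<le> s * x" "s * x \<le> 1"
    using s x by (auto intro: mult_le_one)
  have "(LBINT u:{0<..<x}. gen_inverse H (s * u)) \<le> (LBINT u:{0<..<x}. s powr p * gen_inverse H u)"
    using s x sx p unfolding elasticity_ge_on_def
    by (intro set_integral_mono lborel_set_integrable_scale set_integrable_mult_right
        has_lorenz_curve_integrable[OF H]) auto
  then have "s * (LBINT u:{0<..<x}. gen_inverse H (s * u))
      \<le> s powr (1 + p) * (LBINT u:{0<..<x}. gen_inverse H u)"
    using s by (simp add: powr_add mult_left_mono mult.assoc)
  then show "lorenz H (s * x) \<le> s powr (1 + p) * lorenz H x"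
    using s x sx H unfolding has_lorenz_curve_def
    by (simp add: lorenz_eq_Ioo lborel_set_integral_scale divide_right_mono)
qed

lemma lorenz_elasticity_le:
  assumes H: "has_lorenz_curve H" and p: "elasticity_le_on {0<..<1} p (gen_inverse H)"
  shows "elasticity_le_on {0<..1} (1 + p) (lorenz H)"
  unfolding elasticity_le_on_def
proof (intro ballI)
  fix s x :: real
  assume s: "s \<in> {0<..1}" and x: "x \<in> {0<..1}"
  have sx: "0 \<le> s * x" "s * x \<le> 1"
    using s x by (auto intro: mult_le_one)
  have "(LBINT u:{0<..<x}. s powr p * gen_inverse H u) \<le> (LBINT u:{0<..<x}. gen_inverse H (s * u))"
    using s x sx p unfolding elasticity_le_on_def
    by (intro set_integral_mono lborel_set_integrable_scale set_integrable_mult_right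
        has_lorenz_curve_integrable[OF H]) auto
  then have "s powr (1 + p) * (LBINT u:{0<..<x}. gen_inverse H u)
      \<le> s * (LBINT u:{0<..<x}. gen_inverse H (s * u))"
    using s by (simp add: powr_add mult_left_mono mult.assoc)
  then show "s powr (1 + p) * lorenz H x \<le> lorenz H (s * x)"
    using s x sx H unfolding has_lorenz_curve_def
    by (simp add: lorenz_eq_Ioo lborel_set_integral_scale divide_right_mono)
qed

text \<open>
  The counterpart of convexity of Lorenz curves: a monotone quantile function has elasticity at
  least \<open>0\<close>.
\<close>
lemma lorenz_elasticity_ge_1:
  assumes "has_lorenz_curve H"
  shows "elasticity_ge_on {0<..1} 1 (lorenz H)"
proof -
  have "elasticity_ge_on {0<..<1} 0 (gen_inverse H)"
    unfolding elasticity_ge_on_def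
  proof (intro ballI)
    fix t u :: real
    assume "t \<in> {0<..1}" "u \<in> {0<..<1}"
    then have "0 < t * u" "t * u \<le> u" "u < 1"
      by (auto intro: mult_left_le_one_le)
    then have "gen_inverse H (t * u) \<le> gen_inverse H u"
      using assms unfolding has_lorenz_curve_def
      by (intro mono_onD[of "{0<..<1}" "gen_inverse H"]) simp_all
    then show "gen_inverse H (t * u) \<le> t powr 0 * gen_inverse H u"
      using \<open>t \<in> _\<close> by simp
  qed
  from lorenz_elasticity_ge[OF assms this] show ?thesis by simp
qed

lemma lorenz_unit_interval_df:
  assumes "has_lorenz_curve H"
  shows "unit_interval_df (lorenz H)"
proof -
  have m: "0 < df_mean H" and nn: "\<And>u. u \<in> {0<..<1} \<Longrightarrow> 0 \<le> gen_inverse H u"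
    using assms by (auto simp: has_lorenz_curve_def)
  have z: "lorenz H x = 0" if "x \<le> 0" for x
  proof (cases "x = 0")
    case True
    then show ?thesis by (simp add: lorenz_eq_Ioo set_lebesgue_integral_def)
  qed (use that in \<open>simp add: lorenz_def\<close>)
  have o: "lorenz H x = 1" if "x \<ge> 1" for x
    using that m by (cases "x = 1") (auto simp: lorenz_def df_mean_def)
  have mid: "lorenz H x \<le> lorenz H y" if "0 \<le> x" "x \<le> y" "y \<le> 1" for x y
  proof -
    have "(LBINT u:{0<..<x}. gen_inverse H u) \<le> (LBINT u:{0<..<y}. gen_inverse H u)"
      using has_lorenz_curve_integrable[OF assms, of x] has_lorenz_curve_integrable[OF assms, of y]
        that nn
      unfolding set_integrable_def set_lebesgue_integral_def
      by (intro integral_mono) (auto simp: indicator_def)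
    then show ?thesis
      using that m by (simp add: lorenz_eq_Ioo divide_right_mono)
  qed
  have clamp: "lorenz H x = lorenz H (min 1 (max 0 x))" for x
    using z[of x] z[of 0] o[of x] o[of 1] by (auto simp: min_def max_def)
  have "lorenz H x \<le> lorenz H y" if "x \<le> y" for x y
    unfolding clamp[of x] clamp[of y] using that by (intro mid) auto
  then show ?thesis
    unfolding unit_interval_df_def using z o by (auto intro: monoI)
qed

section \<open>Inversion takes the reciprocal of elasticity\<close>

text \<open>
  The lower bound \<open>c\<close> matters because the infimum of a set that is unbounded below is an arbitrary
  real.
\<close>
lemma gen_inverse_le:
  assumes "\<And>y. y < c \<Longrightarrow> H y < u" and "u \<le> H z"
  shows "gen_inverse H u \<le> z"
  unfolding gen_inverse_def
proof (rule cInf_lower)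
  show "bdd_below {y. u \<le> H y}"
    using assms(1) by (intro bdd_belowI[of _ c]) (metis mem_Collect_eq not_le)
qed (use assms(2) in simp)

lemma le_gen_inverse:
  assumes "u \<le> H z" and "\<And>y. u \<le> H y \<Longrightarrow> c \<le> y"
  shows "c \<le> gen_inverse H u"
  unfolding gen_inverse_def
  using assms by (intro cInf_greatest) auto

lemma gen_inverse_mono:
  assumes "\<And>y. y < c \<Longrightarrow> H y < u" and "u \<le> v" and "v \<le> H z"
  shows "gen_inverse H u \<le> gen_inverse H v"
  using assms by (intro le_gen_inverse[of v H z] gen_inverse_le[of c]) auto

context
  fixes L :: "real \<Rightarrow> real"
  assumes L: "unit_interval_df L"
begin

lemma unit_df_facts:
  "x \<le> 0 \<Longrightarrow> L x = 0" "1 \<le> x \<Longrightarrow> L x = 1" "x \<le> y \<Longrightarrow> L x \<le> L y"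
  using L by (auto simp: unit_interval_df_def mono_def)

lemma gen_inverse_unit_le:
  assumes "0 < u" "u \<le> L z"
  shows "gen_inverse L u \<le> z"
  using assms unit_df_facts(1) by (intro gen_inverse_le[of 0]) auto

lemma le_gen_inverse_unit:
  assumes "0 < u" "u \<le> 1" and "\<And>y. 0 < y \<Longrightarrow> y \<le> 1 \<Longrightarrow> u \<le> L y \<Longrightarrow> c \<le> y"
  shows "c \<le> gen_inverse L u"
proof (rule le_gen_inverse[of u L 1])
  fix y assume y: "u \<le> L y"
  then have "0 < y"
    using unit_df_facts(1)[of y] assms(1) by (cases "y \<le> 0") auto
  show "c \<le> y"
    using assms(3)[of y] assms(3)[of 1] y \<open>0 < y\<close> assms(2) unit_df_facts(2)
    by (cases "y \<le> 1") auto
qed (use assms unit_df_facts in auto)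

text \<open>
  The scaling by \<open>t = s powr (1 / a)\<close> is chosen such that \<open>t powr a = s\<close>. Every point \<open>y\<close> at which
  \<open>L\<close> has reached level \<open>s * u\<close> can then be moved out to \<open>y / t\<close>, where \<open>L\<close> has reached level \<open>u\<close>.
  Thus \<open>1 / t\<close> maps one of the two sets that define the infima into the other.
\<close>
lemma gen_inverse_elasticity_le:
  assumes "elasticity_ge_on {0<..1} a L" "0 < a"
  shows "elasticity_le_on {0<..<1} (1 / a) (gen_inverse L)"
  unfolding elasticity_le_on_def
proof (intro ballI)
  fix s u :: real
  assume s: "s \<in> {0<..1}" and u: "u \<in> {0<..<1}"
  define t where "t = s powr (1 / a)"
  have t: "0 < t" "t \<le> 1" "t powr a = s"
    using s \<open>0 < a\<close> by (auto simp: t_def powr_powr powr_le1)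
  have su: "0 < s * u" "s * u \<le> 1"
    using s u by (auto intro: mult_le_one)
  have "t * gen_inverse L u \<le> y" if y: "0 < y" "y \<le> 1" "s * u \<le> L y" for y
  proof -
    have "u \<le> L (y / t)"
    proof (cases "y / t \<le> 1")
      case True
      then have "L (t * (y / t)) \<le> t powr a * L (y / t)"
        using assms(1) t y unfolding elasticity_ge_on_def by (auto simp del: times_divide_eq_right)
      then have "s * u \<le> s * L (y / t)"
        using t y by simp
      then show ?thesis using s by simp
    next
      case False
      (* Beyond the unit interval the scaling hypothesis is silent, but there L is already 1. *)
      then show ?thesis using unit_df_facts(2)[of "y / t"] u by simp
    qed
    then have "gen_inverse L u \<le> y / t"
      using u by (intro gen_inverse_unit_le) auto
    then show ?thesis using t by (simp add: field_simps)
  qed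
  then show "s powr (1 / a) * gen_inverse L u \<le> gen_inverse L (s * u)"
    unfolding t_def[symmetric] using su by (intro le_gen_inverse_unit) auto
qed

text \<open>
  Dually, a point \<open>y\<close> at which \<open>L\<close> has reached level \<open>u\<close> is moved in to \<open>t * y\<close>, where \<open>L\<close> still
  reaches level \<open>s * u\<close>.
\<close>
lemma gen_inverse_elasticity_ge:
  assumes "elasticity_le_on {0<..1} b L" "0 < b"
  shows "elasticity_ge_on {0<..<1} (1 / b) (gen_inverse L)"
  unfolding elasticity_ge_on_def
proof (intro ballI)
  fix s u :: real
  assume s: "s \<in> {0<..1}" and u: "u \<in> {0<..<1}"
  define t where "t = s powr (1 / b)"
  have t: "0 < t" "t \<le> 1" "t powr b = s"
    using s \<open>0 < b\<close> by (auto simp: t_def powr_powr powr_le1)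
  have "gen_inverse L (s * u) / t \<le> y" if y: "0 < y" "y \<le> 1" "u \<le> L y" for y
  proof -
    have "s * u \<le> s * L y"
      using y s by simp
    also have "\<dots> \<le> L (t * y)"
      using assms(1) t y unfolding elasticity_le_on_def by auto
    finally have "gen_inverse L (s * u) \<le> t * y"
      using s u by (intro gen_inverse_unit_le) auto
    then show ?thesis using t by (simp add: field_simps)
  qed
  then have "gen_inverse L (s * u) / t \<le> gen_inverse L u"
    using u by (intro le_gen_inverse_unit) auto
  then show "gen_inverse L (s * u) \<le> s powr (1 / b) * gen_inverse L u"
    unfolding t_def[symmetric] using t by (simp add: field_simps)
qed

text \<open>
  This is what allows the Lorenz transform to be iterated. The hypothesis yields \<open>L x \<le> x\<close>, so the
  quantile function dominates the identity and its mean is at least \<open>1 / 2\<close>. Without such a bound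
  the mean could vanish, as for the step function that is \<open>1\<close> at every positive argument.
\<close>
lemma unit_df_has_lorenz_curve:
  assumes "elasticity_ge_on {0<..1} 1 L"
  shows "has_lorenz_curve L"
proof -
  let ?g = "gen_inverse L"
  have below: "L x \<le> x" if "0 < x" "x \<le> 1" for x
    using bspec[OF bspec[OF assms[unfolded elasticity_ge_on_def]], of x 1] that
      unit_df_facts(2)[of 1] by simp
  have ge: "u \<le> ?g u" if "u \<in> {0<..<1}" for u
    using that below by (intro le_gen_inverse_unit) (auto intro: order_trans)
  have le: "?g u \<le> 1" if "u \<in> {0<..<1}" for u
    using that unit_df_facts(2)[of 1] by (intro gen_inverse_unit_le) auto
  have mono: "mono_on {0<..<1} ?g"
    using unit_df_facts(1,2) by (intro mono_onI gen_inverse_mono[of 0 _ _ _ 1]) auto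
  have "?g \<in> borel_measurable (restrict_space borel {0<..<1})"
    by (rule borel_measurable_mono_on_fnc[OF mono])
  then have meas: "set_borel_measurable lborel {0<..<1} ?g"
    by (simp add: set_borel_measurable_def borel_measurable_restrict_space_iff)
  have const: "set_integrable lborel {0<..<1} (\<lambda>_::real. 1::real)"
    by (simp add: set_integrable_def)
  have int: "set_integrable lborel {0<..<1} ?g"
    by (rule set_integrable_bound[OF const meas]) (use ge le in \<open>force intro!: AE_I2\<close>)
  have id: "set_integrable lborel {0<..<1} (\<lambda>u::real. u)"
    by (rule set_integrable_bound[OF const]) (auto simp: set_borel_measurable_def)
  have "(LBINT u:{0<..<1}. u) = (LBINT u:{0..1}. u :: real)"
    by (simp add: lborel_set_integral_Icc_eq_Ioo)
  also have "\<dots> = 1 / 2"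
    using integral_power[of 0 1 1] by (simp add: set_lebesgue_integral_def mult.commute)
  finally have "(LBINT u:{0<..<1}. u) = (1 / 2 :: real)" .
  moreover have "(LBINT u:{0<..<1}. u) \<le> df_mean L"
    unfolding df_mean_eq_Ioo by (intro set_integral_mono id int ge)
  ultimately have "0 < df_mean L" by linarith
  with mono ge show ?thesis
    unfolding has_lorenz_curve_def by force
qed

end

section \<open>The golden ratio as an attracting fixed point\<close>

definition golden_ratio :: real where
  "golden_ratio = (1 + sqrt 5) / 2"

lemma golden_ratio_gt_1: "1 < golden_ratio"
  using real_less_rsqrt[of 1 5] by (simp add: golden_ratio_def)

lemma golden_ratio_fixed_point: "golden_ratio = 1 + 1 / golden_ratio"
proof -
  have "golden_ratio * golden_ratio = golden_ratio + 1"
    by (simp add: golden_ratio_def field_simps)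
  then show ?thesis using golden_ratio_gt_1 by (simp add: field_simps)
qed

text \<open>
  Subtracting the fixed point equation gives the exact factor \<open>1 / (a * golden_ratio)\<close>.
\<close>
lemma golden_ratio_contraction:
  assumes "1 \<le> a"
  shows "\<bar>1 + 1 / a - golden_ratio\<bar> \<le> \<bar>a - golden_ratio\<bar> / golden_ratio"
proof -
  have "1 + 1 / a - golden_ratio = 1 / a - 1 / golden_ratio"
    using golden_ratio_fixed_point by linarith
  also have "\<dots> = (golden_ratio - a) / (a * golden_ratio)"
    using assms golden_ratio_gt_1 by (simp add: field_simps)
  finally have "\<bar>1 + 1 / a - golden_ratio\<bar> = \<bar>a - golden_ratio\<bar> / golden_ratio / a"
    using assms golden_ratio_gt_1 by (simp add: abs_mult abs_minus_commute)
  also have "\<dots> \<le> \<bar>a - golden_ratio\<bar> / golden_ratio / 1"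
    using assms golden_ratio_gt_1 by (intro divide_left_mono) auto
  finally show ?thesis by simp
qed

text \<open>
  The derivative of \<open>x powr c\<close> in \<open>c\<close> has absolute value \<open>x powr c * (- ln x)\<close>, and for \<open>c \<ge> 1\<close>
  this is at most \<open>- x * ln x \<le> 1\<close>. The restriction to exponents at least \<open>1\<close> tames the
  logarithm at \<open>0\<close> and makes the bound uniform in \<open>x\<close>.
\<close>
lemma powr_diff_exponent_le:
  fixes x :: real
  assumes "0 < x" "x \<le> 1" "1 \<le> a" "a \<le> b"
  shows "x powr a - x powr b \<le> b - a"
proof -
  have "x powr b = x powr a * x powr (b - a)"
    by (simp add: powr_add[symmetric])
  moreover have "1 - (b - a) * (- ln x) \<le> x powr (b - a)"
    using exp_ge_add_one_self[of "(b - a) * ln x"] assms by (simp add: powr_def)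
  ultimately have "x powr a - x powr b \<le> x powr a * ((b - a) * (- ln x))"
    using mult_left_mono[of "1 - (b - a) * (- ln x)" "x powr (b - a)" "x powr a"]
    by (simp add: algebra_simps)
  also have "\<dots> \<le> x * ((b - a) * (- ln x))"
    using powr_mono'[of 1 a x] assms
    by (intro mult_right_mono mult_nonneg_nonneg) auto
  also have "\<dots> = (b - a) * (x * ln (1 / x))"
    using assms by (simp add: ln_div)
  also have "\<dots> \<le> (b - a) * 1"
  proof (rule mult_left_mono)
    have "x * ln (1 / x) \<le> x * (1 / x - 1)"
      using assms by (intro mult_left_mono ln_le_minus_one) auto
    also have "\<dots> \<le> 1" using assms by (simp add: field_simps)
    finally show "x * ln (1 / x) \<le> 1" .
  qed (use assms in simp)
  finally show ?thesis by simp
qed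

section \<open>Iterating the Lorenz transform\<close>

text \<open>
  The invariant of the iteration. The two bounds \<open>a\<close> and \<open>b\<close> exchange their roles in each step, so
  both are controlled by the same \<open>\<epsilon>\<close>. Elasticity at least \<open>1\<close> appears on its own because it
  guarantees the positive mean that the next step divides by.
\<close>
definition nearly_golden :: "real \<Rightarrow> (real \<Rightarrow> real) \<Rightarrow> bool" where
  "nearly_golden \<epsilon> L \<longleftrightarrow> unit_interval_df L \<and> elasticity_ge_on {0<..1} 1 L \<and>
     (\<exists>a\<ge>1. elasticity_ge_on {0<..1} a L \<and> \<bar>a - golden_ratio\<bar> \<le> \<epsilon>) \<and>
     (\<exists>b\<ge>1. elasticity_le_on {0<..1} b L \<and> \<bar>b - golden_ratio\<bar> \<le> \<epsilon>)"

lemma nearly_goldenI: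
  assumes "unit_interval_df L" and "elasticity_ge_on {0<..1} 1 L"
    and "elasticity_ge_on {0<..1} a L" "1 \<le> a" "\<bar>a - golden_ratio\<bar> \<le> \<epsilon>"
    and "elasticity_le_on {0<..1} b L" "1 \<le> b" "\<bar>b - golden_ratio\<bar> \<le> \<epsilon>"
  shows "nearly_golden \<epsilon> L"
  unfolding nearly_golden_def using assms by (intro conjI exI[of _ a] exI[of _ b])

lemma nearly_goldenE:
  assumes "nearly_golden \<epsilon> L"
  obtains a b where "unit_interval_df L" and "elasticity_ge_on {0<..1} 1 L"
    and "elasticity_ge_on {0<..1} a L" "1 \<le> a" "\<bar>a - golden_ratio\<bar> \<le> \<epsilon>"
    and "elasticity_le_on {0<..1} b L" "1 \<le> b" "\<bar>b - golden_ratio\<bar> \<le> \<epsilon>"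
  using assms unfolding nearly_golden_def by (elim conjE exE) (rule that)

text \<open>
  On the unit interval, comparing \<open>x\<close> with the endpoint \<open>1\<close> in the elasticity bounds squeezes \<open>L x\<close>
  between two powers of \<open>x\<close>. If an exponent lies on the favourable side of the golden ratio, the
  corresponding difference of powers is not even positive.
\<close>
lemma dist_golden_df_le:
  assumes L: "nearly_golden \<epsilon> L"
  shows "dist (L x) (golden_df x) \<le> \<epsilon>"
proof -
  from L obtain a b where df: "unit_interval_df L"
    and a: "elasticity_ge_on {0<..1} a L" "1 \<le> a" "\<bar>a - golden_ratio\<bar> \<le> \<epsilon>"
    and b: "elasticity_le_on {0<..1} b L" "1 \<le> b" "\<bar>b - golden_ratio\<bar> \<le> \<epsilon>"
    by (rule nearly_goldenE)
  note G = golden_df_def golden_ratio_def[symmetric]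
  have L1: "L 1 = 1" using df by (simp add: unit_interval_df_def)
  consider "x \<le> 0" | "0 < x" "x \<le> 1" | "1 < x" by linarith
  then show ?thesis
  proof cases
    case 1
    then have "L x = 0" "golden_df x = 0"
      using df by (auto simp: unit_interval_df_def G)
    then show ?thesis using a by simp
  next
    case 2
    then have "L x \<le> x powr a" "x powr b \<le> L x"
      using bspec[OF bspec[OF a(1)[unfolded elasticity_ge_on_def]], of x 1]
        bspec[OF bspec[OF b(1)[unfolded elasticity_le_on_def]], of x 1] L1 by simp_all
    moreover have "x powr a - x powr golden_ratio \<le> \<epsilon>"
      using powr_diff_exponent_le[of x a golden_ratio] powr_mono'[of golden_ratio a x]
        2 a golden_ratio_gt_1 by (cases "a \<le> golden_ratio") auto
    moreover have "x powr golden_ratio - x powr b \<le> \<epsilon>"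
      using powr_diff_exponent_le[of x golden_ratio b] powr_mono'[of b golden_ratio x]
        2 b golden_ratio_gt_1 by (cases "b \<le> golden_ratio") auto
    ultimately show ?thesis
      using 2 by (simp add: G dist_real_def abs_le_iff)
  next
    case 3
    then have "L x = 1" "golden_df x = 1"
      using df by (auto simp: unit_interval_df_def G)
    then show ?thesis using a by simp
  qed
qed

text \<open>
  Two steps are needed: the first Lorenz curve may vanish on an initial interval and then admits
  no upper elasticity bound.
\<close>
lemma lorenz_lorenz_nearly_golden:
  assumes F: "has_lorenz_curve F"
  shows "nearly_golden 1 (lorenz (lorenz F))"
proof -
  have L1: "unit_interval_df (lorenz F)" "elasticity_ge_on {0<..1} 1 (lorenz F)"
    using F by (rule lorenz_unit_interval_df lorenz_elasticity_ge_1)+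
  have H1: "has_lorenz_curve (lorenz F)"
    by (rule unit_df_has_lorenz_curve[OF L1])
  have "golden_ratio \<le> 2"
    using real_le_lsqrt[of 3 5] by (simp add: golden_ratio_def)
  then have "\<bar>1 - golden_ratio\<bar> \<le> 1" "\<bar>2 - golden_ratio\<bar> \<le> 1" "1 \<le> (1::real)" "1 \<le> (2::real)"
    using golden_ratio_gt_1 by auto
  moreover have "elasticity_le_on {0<..1} 2 (lorenz (lorenz F))"
    using lorenz_elasticity_le[OF H1 gen_inverse_elasticity_le[OF L1]] by simp
  ultimately show ?thesis
    by (intro nearly_goldenI[of _ 1 _ 2] lorenz_unit_interval_df[OF H1] lorenz_elasticity_ge_1[OF H1])
qed

lemma lorenz_nearly_golden:
  assumes "nearly_golden \<epsilon> L"
  shows "nearly_golden (\<epsilon> / golden_ratio) (lorenz L)"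
proof -
  from assms obtain a b where L: "unit_interval_df L" "elasticity_ge_on {0<..1} 1 L"
    and a: "elasticity_ge_on {0<..1} a L" "1 \<le> a" "\<bar>a - golden_ratio\<bar> \<le> \<epsilon>"
    and b: "elasticity_le_on {0<..1} b L" "1 \<le> b" "\<bar>b - golden_ratio\<bar> \<le> \<epsilon>"
    by (rule nearly_goldenE)
  have H: "has_lorenz_curve L"
    by (rule unit_df_has_lorenz_curve[OF L])
  have closer: "\<bar>1 + 1 / c - golden_ratio\<bar> \<le> \<epsilon> / golden_ratio"
    if "1 \<le> c" "\<bar>c - golden_ratio\<bar> \<le> \<epsilon>" for c
    using golden_ratio_contraction[OF that(1)] divide_right_mono[OF that(2), of golden_ratio]
      golden_ratio_gt_1 by simp
  have "elasticity_ge_on {0<..1} (1 + 1 / b) (lorenz L)"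
    using b(2) by (intro lorenz_elasticity_ge[OF H] gen_inverse_elasticity_ge[OF L(1) b(1)]) simp
  moreover have "elasticity_le_on {0<..1} (1 + 1 / a) (lorenz L)"
    using a(2) by (intro lorenz_elasticity_le[OF H] gen_inverse_elasticity_le[OF L(1) a(1)]) simp
  moreover have "1 \<le> 1 + 1 / a" "1 \<le> 1 + 1 / b"
    using a(2) b(2) by simp_all
  ultimately show ?thesis
    by (intro nearly_goldenI[of _ "1 + 1 / b" _ "1 + 1 / a"] lorenz_unit_interval_df[OF H]
        lorenz_elasticity_ge_1[OF H] closer[OF a(2,3)] closer[OF b(2,3)])
qed

lemma lorenz_iter_nearly_golden:
  assumes "has_lorenz_curve F"
  shows "nearly_golden ((1 / golden_ratio) ^ n) (lorenz_iter F (n + 2))"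
proof (induction n)
  case 0
  have "lorenz_iter F (0 + 2) = lorenz (lorenz F)"
    by (simp add: numeral_2_eq_2)
  then show ?case
    using lorenz_lorenz_nearly_golden[OF assms] by simp
next
  case (Suc n)
  have "lorenz_iter F (Suc n + 2) = lorenz (lorenz_iter F (n + 2))"
    and "(1 / golden_ratio) ^ Suc n = (1 / golden_ratio) ^ n / golden_ratio"
    by simp_all
  then show ?case
    using lorenz_nearly_golden[OF Suc.IH] by (simp only:)
qed

section \<open>The initial distribution\<close>

lemma nonneg_random_variable_has_lorenz_curve:
  fixes M :: "'a measure" and X :: "'a \<Rightarrow> real"
  assumes "prob_space M" and X: "X \<in> borel_measurable M" and pos: "AE \<omega> in M. 0 \<le> X \<omega>"
    and mean: "0 < prob_space.expectation M X"
  shows "has_lorenz_curve (cdf (distr M borel X))"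
proof -
  interpret prob_space M by fact
  let ?F = "cdf (distr M borel X)"
  interpret D: real_distribution "distr M borel X"
    by (rule real_distribution_distr[OF X])
  have below: "?F y < u" if "y < 0" "0 < u" for y u
  proof -
    have "AE \<omega> in M. \<not> X \<omega> \<le> y"
      using pos by eventually_elim (use that in auto)
    then have "prob {\<omega> \<in> space M. X \<omega> \<le> y} = 0"
      using X by (subst prob_Collect_eq_0) auto
    moreover have "X -` {..y} \<inter> space M = {\<omega> \<in> space M. X \<omega> \<le> y}" by auto
    ultimately show ?thesis
      using that X by (simp add: cdf_def measure_distr)
  qed
  have above: "\<exists>z. u \<le> ?F z" if "u < 1" for u
    using order_tendstoD(1)[OF D.cdf_lim_at_top_prob that]
    by (metis eventually_happens' trivial_limit_at_top_linorder less_imp_le)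
  have "mono_on {0<..<1} (gen_inverse ?F)"
  proof (rule mono_onI)
    fix u v :: real assume "u \<in> {0<..<1}" "v \<in> {0<..<1}" "u \<le> v"
    moreover then obtain z where "v \<le> ?F z" using above[of v] by auto
    ultimately show "gen_inverse ?F u \<le> gen_inverse ?F v"
      using below by (intro gen_inverse_mono[of 0]) auto
  qed
  moreover have "0 \<le> gen_inverse ?F u" if "u \<in> {0<..<1}" for u
  proof -
    from above[of u] that obtain z where "u \<le> ?F z" by auto
    moreover have "0 \<le> y" if "u \<le> ?F y" for y
      using below[of y u] \<open>u \<in> _\<close> that by (cases "y < 0") auto
    ultimately show ?thesis
      by (rule le_gen_inverse)
  qed
  moreover have "0 < df_mean ?F"
    using df_mean_cdf[OF \<open>prob_space M\<close> X] mean by simp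
  ultimately show ?thesis
    unfolding has_lorenz_curve_def by blast
qed

section \<open>Uniform convergence\<close>

theorem theorem1:
  fixes M :: "'a measure" and X :: "'a \<Rightarrow> real" and F :: "real \<Rightarrow> real"
  assumes "prob_space M"
    and "X \<in> borel_measurable M"
    and "AE \<omega> in M. 0 \<le> X \<omega>"
    and "integrable M X"
    and "0 < prob_space.expectation M X"
    and "F = cdf (distr M borel X)"
  shows "uniform_limit UNIV (lorenz_iter F) golden_df sequentially"
proof (rule uniform_limitI)
  fix e :: real assume "0 < e"
  have F: "has_lorenz_curve F"
    unfolding assms(6) by (rule nonneg_random_variable_has_lorenz_curve[OF assms(1-3,5)])
  have "dist (lorenz_iter F (n + 2) x) (golden_df x) \<le> (1 / golden_ratio) ^ n" for n x
    by (rule dist_golden_df_le[OF lorenz_iter_nearly_golden[OF F]])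
  moreover have "\<forall>\<^sub>F n in sequentially. (1 / golden_ratio) ^ n < e"
    using golden_ratio_gt_1 \<open>0 < e\<close>
    by (intro order_tendstoD(2)[OF LIMSEQ_realpow_zero]) auto
  ultimately have "\<forall>\<^sub>F n in sequentially. \<forall>x\<in>UNIV. dist (lorenz_iter F (n + 2) x) (golden_df x) < e"
    by (auto elim!: eventually_mono intro: le_less_trans)
  then show "\<forall>\<^sub>F n in sequentially. \<forall>x\<in>UNIV. dist (lorenz_iter F n x) (golden_df x) < e"
    by (rule eventually_sequentially_seg[THEN iffD1])
qed

end
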